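(* For every positive integer $n$, $Q(n)=H(8n-1)$.
   Context: $Q(n)$ is the number of partitions of $n$ into consecutive parts, all appearing exactly once except the largest part; equivalently, the number of triples $(l,m,k)$ of integers with $1\le m\le l$ and $k\ge0$ such that $n=m+(m+1)+\cdots+l+kl=\frac{l(l+1)}{2}-\frac{m(m-1)}{2}+kl$. For a positive integer $N\equiv 0,3\pmod 4$, $H(N)$ is the number of classes of positive definite binary quadratic forms of discriminant $-N$, where classes containing a multiple of $x^2+y^2$ (resp. $x^2+xy+y^2$) are counted with weight $1/2$ (resp. $1/3$). *)

theory Defs
  imports "HOL-Library.Multiset" HOL.Rat
begin

definition partitions_of :: "nat \<Rightarrow> nat multiset set" where
  "partitions_of n = {P. 0 \<notin># P \<and> \<Sum>\<^sub># P = n}"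

text \<open>The largest part \<open>l\<close> is allowed, but not required, to be repeated.\<close>

definition consecutive_parts :: "nat multiset \<Rightarrow> bool" where
  "consecutive_parts P \<longleftrightarrow>
     (\<exists>m l. m \<le> l \<and> set_mset P = {m..l} \<and> (\<forall>i\<in>{m..<l}. count P i = 1))"

definition Q :: "nat \<Rightarrow> nat" where
  "Q n = card {P \<in> partitions_of n. consecutive_parts P}"

text \<open>\<open>(a, b, c)\<close> stands for the form \<open>a x\<^sup>2 + b x y + c y\<^sup>2\<close>.\<close>

type_synonym bqf = "int \<times> int \<times> int"

fun bqf_eval :: "bqf \<Rightarrow> int \<Rightarrow> int \<Rightarrow> int" where
  "bqf_eval (a, b, c) x y = a * x\<^sup>2 + b * x * y + c * y\<^sup>2"

fun bqf_disc :: "bqf \<Rightarrow> int" where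
  "bqf_disc (a, b, c) = b\<^sup>2 - 4 * a * c"

definition bqf_pos_def :: "bqf \<Rightarrow> bool" where
  "bqf_pos_def f \<longleftrightarrow> (\<forall>x y. (x, y) \<noteq> (0, 0) \<longrightarrow> bqf_eval f x y > 0)"

text \<open>Forms are not required to be primitive.\<close>

definition pos_def_forms :: "int \<Rightarrow> bqf set" where
  "pos_def_forms D = {f. bqf_pos_def f \<and> bqf_disc f = D}"

text \<open>Proper equivalence, that is, equivalence under \<open>SL\<^sub>2\<close> of the integers.\<close>

definition bqf_equiv :: "bqf \<Rightarrow> bqf \<Rightarrow> bool" where
  "bqf_equiv f g \<longleftrightarrow>
     (\<exists>p q r s. p * s - q * r = 1 \<and>
        (\<forall>x y. bqf_eval g x y = bqf_eval f (p * x + q * y) (r * x + s * y)))"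

definition form_classes :: "int \<Rightarrow> bqf set set" where
  "form_classes D = pos_def_forms D //
     {(f, g). f \<in> pos_def_forms D \<and> g \<in> pos_def_forms D \<and> bqf_equiv f g}"

definition class_weight :: "bqf set \<Rightarrow> rat" where
  "class_weight C =
     (if \<exists>t. (t, 0, t) \<in> C then 1 / 2
      else if \<exists>t. (t, t, t) \<in> C then 1 / 3
      else 1)"

definition H :: "int \<Rightarrow> rat" where
  "H N = (\<Sum>C\<in>form_classes (- N). class_weight C)"

lemma bqf_equiv_refl: "bqf_equiv f f"
  unfolding bqf_equiv_def
  by (rule exI[of _ 1], rule exI[of _ 0], rule exI[of _ 0], rule exI[of _ 1]) simp

lemma bqf_equiv_sym:
  assumes "bqf_equiv f g"
  shows "bqf_equiv g f"
proof -
  from assms obtain p q r s where d: "p * s - q * r = 1"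
    and e: "\<And>x y. bqf_eval g x y = bqf_eval f (p * x + q * y) (r * x + s * y)"
    unfolding bqf_equiv_def by blast
  have "bqf_eval f x y = bqf_eval g (s * x + - q * y) (- r * x + p * y)" for x y
  proof -
    have "p * (s * x + - q * y) + q * (- r * x + p * y) = (p * s - q * r) * x"
      "r * (s * x + - q * y) + s * (- r * x + p * y) = (p * s - q * r) * y"
      by (simp_all add: algebra_simps)
    then show ?thesis by (simp only: e d mult_1)
  qed
  moreover have "s * p - (- q) * (- r) = 1"
    using d by (simp add: algebra_simps)
  ultimately show ?thesis unfolding bqf_equiv_def by blast
qed

lemma bqf_equiv_trans:
  assumes "bqf_equiv f g" "bqf_equiv g h"
  shows "bqf_equiv f h"
proof -
  from assms(1) obtain p q r s where d: "p * s - q * r = 1"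
    and e: "\<And>x y. bqf_eval g x y = bqf_eval f (p * x + q * y) (r * x + s * y)"
    unfolding bqf_equiv_def by blast
  from assms(2) obtain p' q' r' s' where d': "p' * s' - q' * r' = 1"
    and e': "\<And>x y. bqf_eval h x y = bqf_eval g (p' * x + q' * y) (r' * x + s' * y)"
    unfolding bqf_equiv_def by blast
  have "(p * p' + q * r') * (r * q' + s * s') - (p * q' + q * s') * (r * p' + s * r')
      = (p * s - q * r) * (p' * s' - q' * r')"
    by (simp add: algebra_simps)
  then have "(p * p' + q * r') * (r * q' + s * s') - (p * q' + q * s') * (r * p' + s * r') = 1"
    using d d' by simp
  moreover have "bqf_eval h x y = bqf_eval f ((p * p' + q * r') * x + (p * q' + q * s') * y)
      ((r * p' + s * r') * x + (r * q' + s * s') * y)" for x y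
    unfolding e' e by (simp add: algebra_simps)
  ultimately show ?thesis unfolding bqf_equiv_def by blast
qed

lemma equiv_bqf_equiv:
  "equiv (pos_def_forms D)
     {(f, g). f \<in> pos_def_forms D \<and> g \<in> pos_def_forms D \<and> bqf_equiv f g}"
  by (rule equivI)
    (auto simp: refl_on_def sym_def trans_def
       intro: bqf_equiv_refl bqf_equiv_sym bqf_equiv_trans)

lemma Q_eq_card_triples:
  "Q n = card {(l, m, k). 1 \<le> m \<and> m \<le> l \<and> n = (\<Sum>i=m..l. i) + k * l}"
proof -
  define F :: "nat \<times> nat \<times> nat \<Rightarrow> nat multiset"
    where "F = (\<lambda>(l, m, k). mset_set {m..l} + replicate_mset k l)"
  let ?T = "{(l, m, k). 1 \<le> m \<and> m \<le> l \<and> n = (\<Sum>i=m..l. i) + k * l}"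
  have set_F: "set_mset (F (l, m, k)) = {m..l}" if "m \<le> l" for l m k
    using that by (auto simp: F_def)
  have count_F: "count (F (l, m, k)) i = (if i \<in> {m..l} then 1 else 0) + (if i = l then k else 0)"
    for l m k i
    by (simp add: F_def)
  have sum_F: "\<Sum>\<^sub># (F (l, m, k)) = (\<Sum>i=m..l. i) + k * l" for l m k
    by (simp add: F_def sum_unfold_sum_mset)
  have "bij_betw F ?T {P \<in> partitions_of n. consecutive_parts P}"
    unfolding bij_betw_def
  proof
    show "inj_on F ?T"
    proof (rule inj_onI)
      fix x y assume x: "x \<in> ?T" and y: "y \<in> ?T" and eq: "F x = F y"
      obtain l m k where x': "x = (l, m, k)" by (cases x) auto
      obtain l' m' k' where y': "y = (l', m', k')" by (cases y) auto
      have ml: "m \<le> l" "m' \<le> l'" using x y x' y' by auto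
      have "{m..l} = {m'..l'}" using set_F[OF ml(1), of k] set_F[OF ml(2), of k'] eq x' y' by metis
      then have "m = m'" "l = l'" using ml by (auto simp: Icc_eq_Icc)
      moreover have "count (F (l, m, k)) l = count (F (l', m', k')) l" using eq x' y' by simp
      ultimately show "x = y" using ml x' y' by (simp add: count_F)
    qed
    show "F ` ?T = {P \<in> partitions_of n. consecutive_parts P}"
    proof (intro equalityI subsetI)
      fix P assume "P \<in> F ` ?T"
      then obtain l m k where t: "1 \<le> m" "m \<le> l" "n = (\<Sum>i=m..l. i) + k * l"
        and P: "P = F (l, m, k)" by auto
      have "consecutive_parts P"
        unfolding consecutive_parts_def P
        by (rule exI[of _ m], rule exI[of _ l]) (use t in \<open>simp add: set_F count_F\<close>)
      then show "P \<in> {P \<in> partitions_of n. consecutive_parts P}"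
        using t by (simp add: partitions_of_def P sum_F set_F)
    next
      fix P assume "P \<in> {P \<in> partitions_of n. consecutive_parts P}"
      then obtain m l where P0: "0 \<notin># P" and Pn: "\<Sum>\<^sub># P = n" and ml: "m \<le> l"
        and S: "set_mset P = {m..l}" and c: "\<forall>i\<in>{m..<l}. count P i = 1"
        unfolding partitions_of_def consecutive_parts_def by blast
      define k where "k = count P l - 1"
      have "count P l > 0" using S ml by (simp add: count_greater_zero_iff)
      then have "P = F (l, m, k)"
      proof (intro multiset_eqI)
        fix i assume l: "count P l > 0"
        have "count P i = 0" if "i \<notin> {m..l}" using that S by (metis not_in_iff)
        then show "count P i = count (F (l, m, k)) i"
          using c l ml by (auto simp: count_F k_def)
      qed
      moreover have "m \<ge> 1" using P0 S ml by (cases m) auto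
      ultimately show "P \<in> F ` ?T" using ml Pn sum_F by (intro image_eqI[of _ _ "(l, m, k)"]) auto
    qed
  qed
  then show ?thesis unfolding Q_def by (simp add: bij_betw_same_card)
qed

end

theory Submission imports Defs begin

text \<open>
  Multiplying \<open>n = l (l + 1) / 2 - m (m - 1) / 2 + k l\<close> by \<open>8\<close> gives
  \<open>(2 m - 1)\<^sup>2 - 4 l (l + 1 + 2 k) = 1 - 8 n\<close>, so the triples are the forms
  \<open>(a, b, c) = (l, 2 m - 1, l + 1 + 2 k)\<close> of discriminant \<open>1 - 8 n\<close> with \<open>0 < b < 2 a\<close>, \<open>a < c\<close>
  and \<open>a + c\<close> odd. Their roots lie in the half \<open>-1 < Re z < 0\<close>, \<open>\<bar>z\<bar> > 1\<close> of the standard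
  fundamental domain of the theta group, which has index \<open>3\<close> in the modular group. As
  \<open>1 - 8 n\<close> is a square modulo \<open>8\<close>, exactly one of \<open>a\<close>, \<open>c\<close>, \<open>a + b + c\<close> is odd, and requiring
  \<open>a + c\<close> odd retains two of the three translates of each reduced form; the symmetry
  \<open>b \<mapsto> -b\<close> then leaves one for each class on the half domain. The parity condition also
  keeps all forms away from the boundary, and no class has an extra automorphism.
\<close>

section \<open>Gauss reduction of positive definite forms\<close>

lemma pos_def_forms_iff:
  assumes "D < 0"
  shows "(a, b, c) \<in> pos_def_forms D \<longleftrightarrow> a > 0 \<and> b\<^sup>2 - 4 * a * c = D"
proof
  assume "(a, b, c) \<in> pos_def_forms D"
  then have "bqf_eval (a, b, c) 1 0 > 0" "b\<^sup>2 - 4 * a * c = D"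
    unfolding pos_def_forms_def bqf_pos_def_def mem_Collect_eq
    by (metis prod.inject zero_neq_one, simp)
  then show "a > 0 \<and> b\<^sup>2 - 4 * a * c = D" by simp
next
  assume "a > 0 \<and> b\<^sup>2 - 4 * a * c = D"
  then have a: "a > 0" and D: "b\<^sup>2 - 4 * a * c = D" by auto
  have "bqf_eval (a, b, c) x y > 0" if "(x, y) \<noteq> (0, 0)" for x y
  proof -
    have "4 * a * bqf_eval (a, b, c) x y = (2 * a * x + b * y)\<^sup>2 + (4 * a * c - b\<^sup>2) * y\<^sup>2"
      by (simp add: algebra_simps power2_eq_square)
    also have "\<dots> = (2 * a * x + b * y)\<^sup>2 + (- D) * y\<^sup>2" by (simp flip: D)
    also have "\<dots> > 0"
    proof (cases "y = 0")
      case True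
      then show ?thesis using that a by simp
    next
      case False
      then have "(- D) * y\<^sup>2 > 0" using assms by (intro mult_pos_pos) auto
      then show ?thesis by (intro add_nonneg_pos) auto
    qed
    finally show ?thesis using a by (simp add: zero_less_mult_iff)
  qed
  then show "(a, b, c) \<in> pos_def_forms D"
    using D unfolding pos_def_forms_def bqf_pos_def_def by auto
qed

text \<open>The root lies in the standard fundamental domain; the last clause keeps one of any two
  identified boundary points.\<close>

definition reduced :: "bqf \<Rightarrow> bool" where
  "reduced = (\<lambda>(a, b, c). \<bar>b\<bar> \<le> a \<and> a \<le> c \<and> (\<bar>b\<bar> = a \<or> a = c \<longrightarrow> b \<ge> 0))"

definition reduced_forms :: "int \<Rightarrow> bqf set" where
  "reduced_forms D = {f \<in> pos_def_forms D. reduced f}"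

lemma bqf_equiv_shift: "bqf_equiv (a, b, c) (a, b + 2 * a * k, a * k\<^sup>2 + b * k + c)"
  unfolding bqf_equiv_def
  by (rule exI[of _ 1], rule exI[of _ k], rule exI[of _ 0], rule exI[of _ 1])
    (simp add: algebra_simps power2_eq_square)

lemma bqf_equiv_swap: "bqf_equiv (a, b, c) (c, - b, a)"
  unfolding bqf_equiv_def
  by (rule exI[of _ 0], rule exI[of _ "- 1"], rule exI[of _ 1], rule exI[of _ 0]) simp

text \<open>Gauss's algorithm: shift \<open>b\<close> into \<open>(-a, a]\<close>, then swap while
  the last coefficient is below \<open>a\<close>; each such swap lowers the leading
  coefficient.\<close>

lemma ex_reduced_form:
  assumes "D < 0" "f \<in> pos_def_forms D"
  shows "\<exists>g\<in>reduced_forms D. bqf_equiv f g"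
  using assms(2)
proof (induction "nat (fst f)" arbitrary: f rule: less_induct)
  case less
  obtain a b c where f: "f = (a, b, c)" by (cases f) auto
  have a: "a > 0" and D: "b\<^sup>2 - 4 * a * c = D"
    using less.prems pos_def_forms_iff[OF assms(1)] f by auto
  \<comment> \<open>The quotient that leaves \<open>a - b'\<close> as remainder modulo
    \<open>2 * a\<close>, hence \<open>- a < b' \<le> a\<close>.\<close>
  define k where "k = (a - b) div (2 * a)"
  define b' where "b' = b + 2 * a * k"
  define c' where "c' = a * k\<^sup>2 + b * k + c"
  have "a - b' = (a - b) mod (2 * a)"
    unfolding b'_def k_def by (simp add: minus_mult_div_eq_mod [symmetric])
  then have b': "- a < b'" "b' \<le> a"
    using a pos_mod_bound[of "2 * a" "a - b"] pos_mod_sign[of "2 * a" "a - b"] by linarith+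
  have D': "b'\<^sup>2 - 4 * a * c' = D"
    using D unfolding b'_def c'_def by (simp add: algebra_simps power2_eq_square)
  have eq: "bqf_equiv f (a, b', c')"
    unfolding f b'_def c'_def by (rule bqf_equiv_shift)
  have eq': "bqf_equiv f (c', - b', a)"
    using bqf_equiv_trans[OF eq bqf_equiv_swap] .
  have "a * c' > 0"
    using D' assms(1) zero_le_power2[of b'] by linarith
  then have c': "c' > 0" using a by (simp add: zero_less_mult_iff)
  have mem: "(a, b', c') \<in> pos_def_forms D" "(c', - b', a) \<in> pos_def_forms D"
    using a c' D' by (simp_all add: pos_def_forms_iff[OF assms(1)] mult.commute mult.left_commute)
  consider "c' < a" | "a < c' \<or> (a = c' \<and> b' \<ge> 0)" | "a = c'" "b' < 0" by linarith
  then show ?case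
  proof cases
    case 1
    then have "nat (fst (c', - b', a)) < nat (fst f)" using f c' by simp
    from less.hyps[OF this mem(2)] show ?thesis using bqf_equiv_trans[OF eq'] by blast
  next
    case 2
    then have "(a, b', c') \<in> reduced_forms D"
      using mem(1) b' by (auto simp: reduced_forms_def reduced_def)
    then show ?thesis using eq by blast
  next
    case 3
    then have "(c', - b', a) \<in> reduced_forms D"
      using mem(2) b' by (auto simp: reduced_forms_def reduced_def)
    then show ?thesis using eq' by blast
  qed
qed

text \<open>With \<open>u = \<bar>x\<bar>\<close> and \<open>v = \<bar>y\<bar>\<close>, the value is
  at least \<open>a * (u\<^sup>2 - u * v + v\<^sup>2) + (c - a) * v\<^sup>2\<close>, where the
  bracketed quadratic and \<open>v\<^sup>2\<close> are at least 1.\<close>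

lemma reduced_eval_ge_last:
  assumes "\<bar>b\<bar> \<le> a" "a \<le> c" "y \<noteq> 0"
  shows "bqf_eval (a, b, c) x y \<ge> c"
proof -
  define u v where "u = \<bar>x\<bar>" and "v = \<bar>y\<bar>"
  have uv: "u \<ge> 0" "v \<ge> 1" using assms by (auto simp: u_def v_def)
  have "0 \<le> (u - v)\<^sup>2" "u * v \<ge> 0" "(u \<ge> 1 \<Longrightarrow> u * v \<ge> 1)" "v\<^sup>2 \<ge> 1"
    using uv mult_mono[of 1 u 1 v] power_mono[of 1 v 2] by auto
  then have 1: "u\<^sup>2 - u * v + v\<^sup>2 \<ge> 1"
    using uv by (cases "u = 0") (auto simp: power2_diff)
  have "\<bar>b * x * y\<bar> \<le> a * (u * v)"
    using mult_right_mono[OF assms(1), of "u * v"] uv by (simp add: abs_mult u_def v_def mult.assoc)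
  then have "bqf_eval (a, b, c) x y \<ge> a * u\<^sup>2 - a * (u * v) + c * v\<^sup>2"
    by (simp add: u_def v_def)
  moreover have "a * u\<^sup>2 - a * (u * v) + c * v\<^sup>2 = a * (u\<^sup>2 - u * v + v\<^sup>2) + (c - a) * v\<^sup>2"
    by (simp add: algebra_simps)
  moreover have "a * (u\<^sup>2 - u * v + v\<^sup>2) + (c - a) * v\<^sup>2 \<ge> a * 1 + (c - a) * 1"
    using assms 1 \<open>v\<^sup>2 \<ge> 1\<close> by (intro add_mono mult_left_mono) auto
  ultimately show ?thesis by simp
qed

lemma reduced_eval_ge_first:
  assumes "\<bar>b\<bar> \<le> a" "a \<le> c" "(x, y) \<noteq> (0, 0)"
  shows "bqf_eval (a, b, c) x y \<ge> a"
proof (cases "y = 0")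
  case True
  then have "x\<^sup>2 \<ge> 1" using assms by (simp add: int_one_le_iff_zero_less)
  then have "a * x\<^sup>2 \<ge> a * 1" using assms by (intro mult_left_mono) auto
  then show ?thesis using True by simp
next
  case False
  then show ?thesis using reduced_eval_ge_last[OF assms(1,2)] assms(2) by (meson order_trans)
qed

text \<open>Equivalent forms have the same minimum over nonzero vectors, which is the leading
  coefficient. If \<open>r = 0\<close>, the middle coefficient moves by a multiple of
  \<open>2 * a\<close>; if \<open>r \<noteq> 0\<close>, the bounds force \<open>a = c = c'\<close>.
  Either way at most a sign is open, and the boundary clause fixes it.\<close>

lemma reduced_form_unique:
  assumes "D < 0" "f \<in> reduced_forms D" "g \<in> reduced_forms D" "bqf_equiv f g"
  shows "f = g"
proof -
  obtain a b c where f: "f = (a, b, c)" by (cases f) auto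
  obtain a' b' c' where g: "g = (a', b', c')" by (cases g) auto
  have a: "a > 0" "b\<^sup>2 - 4 * a * c = D" "\<bar>b\<bar> \<le> a" "a \<le> c" "\<bar>b\<bar> = a \<or> a = c \<Longrightarrow> b \<ge> 0"
    using assms(2) pos_def_forms_iff[OF assms(1)] f by (auto simp: reduced_forms_def reduced_def)
  have a': "a' > 0" "b'\<^sup>2 - 4 * a' * c' = D" "\<bar>b'\<bar> \<le> a'" "a' \<le> c'" "\<bar>b'\<bar> = a' \<or> a' = c' \<Longrightarrow> b' \<ge> 0"
    using assms(3) pos_def_forms_iff[OF assms(1)] g by (auto simp: reduced_forms_def reduced_def)
  obtain p q r s where d: "p * s - q * r = 1"
    and e: "\<And>x y. bqf_eval g x y = bqf_eval f (p * x + q * y) (r * x + s * y)"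
    using assms(4) unfolding bqf_equiv_def by blast
  have e1: "a' = bqf_eval f p r" using e[of 1 0] g by simp
  \<comment> \<open>The substitution sends \<open>(s, - r)\<close> to \<open>(1, 0)\<close>.\<close>
  have e2: "a = bqf_eval g s (- r)"
  proof -
    have "p * s + q * (- r) = 1" "r * s + s * (- r) = 0" using d by auto
    then show ?thesis unfolding e by (simp add: f)
  qed
  have "a' \<ge> a" unfolding e1 f by (rule reduced_eval_ge_first[OF a(3,4)]) (use d in auto)
  moreover have "a \<ge> a'"
    by (subst e2, unfold g, rule reduced_eval_ge_first[OF a'(3,4)]) (use d in auto)
  ultimately have aa: "a' = a" by simp
  have "b' = b"
  proof (cases "r = 0")
    case True
    then have ps: "p * s = 1" using d by simp
    have "b' = bqf_eval g 1 1 - bqf_eval g 1 0 - bqf_eval g 0 1" by (simp add: g)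
    also have "\<dots> = 2 * a * (p * q) + b * (p * s)"
      unfolding e using True by (simp add: f algebra_simps power2_eq_square)
    finally have b': "b' = 2 * a * (p * q) + b" using ps by simp
    have "p * q = 0"
    proof (rule ccontr)
      assume "p * q \<noteq> 0"
      then consider "p * q \<ge> 1" | "p * q \<le> - 1" by linarith
      then show False
      proof cases
        case 1
        then have "a * (p * q) \<ge> a * 1" using a(1) by (intro mult_left_mono) auto
        then have "b' = a" "b = - a" using b' a a' aa by linarith+
        then show False using a by auto
      next
        case 2
        then have "a * (p * q) \<le> a * (- 1)" using a(1) by (intro mult_left_mono) auto
        then have "b' = - a" "b = a" using b' a a' aa by linarith+
        then show False using a' aa a by auto
      qed
    qed
    then show ?thesis using b' by simp
  next
    case False
    have "a' \<ge> c" unfolding e1 f by (rule reduced_eval_ge_last[OF a(3,4) False])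
    moreover have "a \<ge> c'"
      by (subst e2, unfold g, rule reduced_eval_ge_last[OF a'(3,4)]) (use False in auto)
    ultimately have c: "c = a" "c' = a" using a a' aa by auto
    then have "b'\<^sup>2 = b\<^sup>2" "b \<ge> 0" "b' \<ge> 0" using a a' aa by auto
    then show ?thesis by (simp add: power2_eq_iff_nonneg)
  qed
  moreover have "a * c' = a * c"
  proof -
    have "b\<^sup>2 - 4 * a * c' = D" using a'(2) aa \<open>b' = b\<close> by simp
    with a(2) show ?thesis by linarith
  qed
  ultimately show ?thesis using f g aa a(1) by simp
qed

lemma card_form_classes:
  assumes "D < 0"
  shows "card (form_classes D) = card (reduced_forms D)"
proof -
  define E where "E = {(f, g). f \<in> pos_def_forms D \<and> g \<in> pos_def_forms D \<and> bqf_equiv f g}"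
  have E: "equiv (pos_def_forms D) E" unfolding E_def by (rule equiv_bqf_equiv)
  have sub: "reduced_forms D \<subseteq> pos_def_forms D" by (auto simp: reduced_forms_def)
  have "bij_betw (\<lambda>f. E `` {f}) (reduced_forms D) (pos_def_forms D // E)"
    unfolding bij_betw_def
  proof
    show "inj_on (\<lambda>f. E `` {f}) (reduced_forms D)"
    proof (rule inj_onI)
      fix f g assume fg: "f \<in> reduced_forms D" "g \<in> reduced_forms D" "E `` {f} = E `` {g}"
      then have "(f, g) \<in> E" using eq_equiv_class[OF _ E] sub by blast
      then show "f = g" using reduced_form_unique[OF assms fg(1,2)] by (simp add: E_def)
    qed
    show "(\<lambda>f. E `` {f}) ` reduced_forms D = pos_def_forms D // E"
    proof (intro equalityI subsetI)
      fix C assume "C \<in> pos_def_forms D // E"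
      then obtain f where f: "f \<in> pos_def_forms D" "C = E `` {f}" by (auto elim: quotientE)
      obtain g where g: "g \<in> reduced_forms D" "bqf_equiv f g"
        using ex_reduced_form[OF assms f(1)] by blast
      then have "(f, g) \<in> E" using f sub by (auto simp: E_def)
      then show "C \<in> (\<lambda>f. E `` {f}) ` reduced_forms D"
        using equiv_class_eq[OF E] f g by blast
    qed (use sub in \<open>auto intro: quotientI\<close>)
  qed
  then show ?thesis unfolding form_classes_def E_def by (simp add: bij_betw_same_card)
qed

section \<open>Reduced forms and forms in the half theta domain\<close>

definition half_theta_forms :: "int \<Rightarrow> bqf set" where
  "half_theta_forms D =
     {(a, b, c). 0 < b \<and> b < 2 * a \<and> a < c \<and> odd (a + c) \<and> b\<^sup>2 - 4 * a * c = D}"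

text \<open>An odd square is 1 modulo 8, so \<open>4 * a * c\<close> is divisible by 8.\<close>

lemma parity_of_coeffs:
  fixes a b c n :: int
  assumes "b\<^sup>2 - 4 * a * c = 1 - 8 * n"
  shows "odd b" "even a \<or> even c"
proof -
  show "odd b"
  proof
    assume "even b"
    then have "even (b\<^sup>2 - 4 * a * c)" by simp
    then show False unfolding assms by simp
  qed
  then obtain k where b: "b = 2 * k + 1" by (auto elim: oddE)
  have "b\<^sup>2 = 4 * (k * (k + 1)) + 1" unfolding b by (simp add: algebra_simps power2_eq_square)
  then have "a * c = k * (k + 1) + 2 * n" using assms by linarith
  moreover have "even (k * (k + 1) + 2 * n)" by simp
  ultimately show "even a \<or> even c" by (metis even_mult_iff)
qed

text \<open>Shifting \<open>x\<close> by \<open>- y\<close> yields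
  \<open>(a, b - 2 * a, a + c - b)\<close>, and the discriminant ignores the sign of the middle
  coefficient.\<close>

lemma disc_fold:
  fixes a b c :: int
  shows "(2 * a - b)\<^sup>2 - 4 * a * (a + c - b) = b\<^sup>2 - 4 * a * c"
  by (simp add: algebra_simps power2_eq_square)

text \<open>
  Up to sign of the middle coefficient, a reduced form has the three translates \<open>(a, b, c)\<close>,
  \<open>(a, 2 a - b, a + c - b)\<close>, \<open>(c, 2 c - b, a + c - b)\<close> in the theta domain, of which those with
  \<open>a + c\<close> odd, \<open>c\<close> even, \<open>a\<close> even respectively are admissible. Two of them are, and the sign of
  \<open>b\<close> decides which one is assigned to the form.
\<close>

definition unfold_form :: "bqf \<Rightarrow> bqf" where
  "unfold_form = (\<lambda>(a, b, c).
     if 0 < b \<and> odd (a + c) then (a, b, c)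
     else if b < 0 \<and> even a then (c, 2 * c + b, a + c + b)
     else (a, 2 * a - \<bar>b\<bar>, a + c - \<bar>b\<bar>))"

text \<open>Inverse to \<open>unfold_form\<close>: \<open>b \<le> a\<close>, \<open>c < b\<close>
  and \<open>a < b \<le> c\<close> tell the three translates apart. The last arises from both signs
  of the middle coefficient, positive for even \<open>a\<close> and negative for odd
  \<open>a\<close>.\<close>

definition fold_form :: "bqf \<Rightarrow> bqf" where
  "fold_form = (\<lambda>(a, b, c).
     if b \<le> a then (a, b, c)
     else if c < b then (a + c - b, b - 2 * a, a)
     else (a, if even a then 2 * a - b else b - 2 * a, a + c - b))"

lemma card_half_theta_forms:
  fixes n :: int
  assumes "n > 0"
  shows "card (reduced_forms (1 - 8 * n)) = card (half_theta_forms (1 - 8 * n))"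
proof -
  let ?D = "1 - 8 * n"
  have D: "?D < 0" using assms by simp
  have red: "(a, b, c) \<in> reduced_forms ?D \<longleftrightarrow>
      a > 0 \<and> b\<^sup>2 - 4 * a * c = ?D \<and> \<bar>b\<bar> \<le> a \<and> a \<le> c \<and> (\<bar>b\<bar> = a \<or> a = c \<longrightarrow> b \<ge> 0)" for a b c
    by (auto simp: reduced_forms_def reduced_def pos_def_forms_iff[OF D])
  have half: "(a, b, c) \<in> half_theta_forms ?D \<longleftrightarrow>
      0 < b \<and> b < 2 * a \<and> a < c \<and> odd (a + c) \<and> b\<^sup>2 - 4 * a * c = ?D" for a b c
    by (simp add: half_theta_forms_def)
  have unfold: "unfold_form f \<in> half_theta_forms ?D \<and> fold_form (unfold_form f) = f"
    if "f \<in> reduced_forms ?D" for f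
  proof -
    obtain a b c where f: "f = (a, b, c)" by (cases f) auto
    have r: "a > 0" "b\<^sup>2 - 4 * a * c = ?D" "\<bar>b\<bar> \<le> a" "a \<le> c" "\<bar>b\<bar> = a \<or> a = c \<longrightarrow> b \<ge> 0"
      using that by (auto simp: f red)
    have p: "odd b" "even a \<or> even c" using parity_of_coeffs[OF r(2)] by auto
    have b0: "b \<noteq> 0" using p by auto
    consider (1) "0 < b" "odd (a + c)" | (2) "b < 0" "even a"
      | (3) "0 < b" "even a" "even c" | (4) "b < 0" "odd a" "even c"
      using p b0 by fastforce
    then show ?thesis
    proof cases
      case 1
      then have "a < c" using r by (cases "a = c") auto
      then show ?thesis using 1 r p by (simp add: f unfold_form_def fold_form_def half)
    next
      case 2
      then have "unfold_form f = (c, 2 * c + b, a + c + b)" by (simp add: f unfold_form_def)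
      moreover have "(2 * c + b)\<^sup>2 - 4 * c * (a + c + b) = ?D"
        using r(2) by (simp add: algebra_simps power2_eq_square)
      \<comment> \<open>As \<open>b < 0\<close>, the boundary clause makes both bounds
        strict.\<close>
      moreover have "a < c" "- b < a" using 2 r by linarith+
      ultimately show ?thesis using 2 r p by (simp add: f fold_form_def half)
    next
      case 3
      then have u: "unfold_form f = (a, 2 * a - b, a + c - b)" by (simp add: f unfold_form_def)
      have "b \<noteq> a" using 3 p by auto
      then show ?thesis using 3 r p disc_fold[of a b c] by (simp add: u fold_form_def half) (simp add: f)
    next
      case 4
      then have u: "unfold_form f = (a, 2 * a - (- b), a + c - (- b))" by (simp add: f unfold_form_def)
      have "a < c" "- b < a" using 4 r by linarith+
      then show ?thesis using 4 r p disc_fold[of a "- b" c] by (simp add: u fold_form_def half) (simp add: f)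
    qed
  qed
  have fold: "fold_form f \<in> reduced_forms ?D \<and> unfold_form (fold_form f) = f"
    if "f \<in> half_theta_forms ?D" for f
  proof -
    obtain a b c where f: "f = (a, b, c)" by (cases f) auto
    have r: "0 < b" "b < 2 * a" "a < c" "odd (a + c)" "b\<^sup>2 - 4 * a * c = ?D"
      using that by (auto simp: f half)
    have p: "odd b" "even a \<or> even c" using parity_of_coeffs[OF r(5)] by auto
    have d: "(2 * a - b)\<^sup>2 - 4 * a * (a + c - b) = ?D" using disc_fold r(5) by simp
    then have d': "(b - 2 * a)\<^sup>2 - 4 * a * (a + c - b) = ?D" by (simp add: power2_commute)
    \<comment> \<open>This parity sends the folded form back through the right branch of
      \<open>unfold_form\<close> in cases 2 and 3.\<close>
    have e: "even (a + c - b)" using r p by simp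
    consider (1) "b \<le> a" | (2) "a < b" "c < b" | (3) "a < b" "b \<le> c" "even a"
      | (4) "a < b" "b \<le> c" "odd a" by linarith
    then show ?thesis
    proof cases
      case 1
      then show ?thesis using r p by (simp add: f fold_form_def unfold_form_def red)
    next
      case 2
      moreover have "(b - 2 * a)\<^sup>2 - 4 * (a + c - b) * a = ?D"
        using d' by (simp only: mult.commute mult.left_commute)
      ultimately show ?thesis using r p e by (simp add: f fold_form_def unfold_form_def red)
    next
      case 3
      then show ?thesis using r p e d by (simp add: f fold_form_def unfold_form_def red)
    next
      case 4
      \<comment> \<open>Here \<open>c\<close> is even and \<open>b\<close> odd. Equality would fold
        to equal outer coefficients with a negative middle one, which is not reduced.\<close>
      then have "b \<noteq> c" using p by auto
      then show ?thesis using 4 r p e d' by (auto simp: f fold_form_def unfold_form_def red)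
    qed
  qed
  have "bij_betw unfold_form (reduced_forms ?D) (half_theta_forms ?D)"
    by (rule bij_betw_byWitness[where f' = fold_form]) (use unfold fold in auto)
  then show ?thesis by (rule bij_betw_same_card)
qed

section \<open>Triples as forms, and the class weights\<close>

lemma eight_sum_Icc:
  fixes m l :: nat
  assumes "1 \<le> m" "m \<le> l"
  shows "8 * int (\<Sum>i=m..l. i) = 4 * int l * (int l + 1) - (2 * int m - 1)\<^sup>2 + 1"
  using assms(2)
proof (induction l rule: dec_induct)
  case base
  then show ?case by (simp add: algebra_simps power2_eq_square)
next
  case (step l)
  then show ?case by (simp add: algebra_simps power2_eq_square)
qed

text \<open>With \<open>a = l\<close> and \<open>b = 2 * m - 1\<close>, the bounds
  \<open>1 \<le> m \<le> l\<close> become \<open>0 < b < 2 * a\<close>;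
  \<open>c - a = 1 + 2 * k\<close> with \<open>k \<ge> 0\<close> becomes \<open>a < c\<close> with
  \<open>a + c\<close> odd.\<close>

lemma Q_eq_card_half_theta_forms: "Q n = card (half_theta_forms (1 - 8 * int n))"
proof -
  let ?T = "{(l, m, k). 1 \<le> m \<and> m \<le> l \<and> n = (\<Sum>i=m..l. i) + k * l}"
  define F :: "nat \<times> nat \<times> nat \<Rightarrow> bqf"
    where "F = (\<lambda>(l, m, k). (int l, 2 * int m - 1, int l + 1 + 2 * int k))"
  have disc: "(2 * int m - 1)\<^sup>2 - 4 * int l * (int l + 1 + 2 * int k) = 1 - 8 * int n
      \<longleftrightarrow> n = (\<Sum>i=m..l. i) + k * l" if "1 \<le> m" "m \<le> l" for l m k
  proof -
    have "n = (\<Sum>i=m..l. i) + k * l \<longleftrightarrow> 8 * int n = 8 * int ((\<Sum>i=m..l. i) + k * l)"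
      by (simp only: mult_cancel_left of_nat_eq_iff) simp
    also have "8 * int ((\<Sum>i=m..l. i) + k * l)
        = 4 * int l * (int l + 1) - (2 * int m - 1)\<^sup>2 + 1 + 8 * int k * int l"
      using eight_sum_Icc[OF that] by simp
    finally show ?thesis by (auto simp: algebra_simps)
  qed
  have "bij_betw F ?T (half_theta_forms (1 - 8 * int n))"
    unfolding bij_betw_def
  proof
    show "inj_on F ?T" by (auto simp: inj_on_def F_def)
    show "F ` ?T = half_theta_forms (1 - 8 * int n)"
    proof (intro equalityI subsetI)
      fix f assume "f \<in> F ` ?T"
      then obtain l m k where t: "1 \<le> m" "m \<le> l" "n = (\<Sum>i=m..l. i) + k * l"
        and f: "f = F (l, m, k)" by auto
      show "f \<in> half_theta_forms (1 - 8 * int n)"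
        using t(1,2) disc[OF t(1,2), THEN iffD2, OF t(3)]
        by (simp add: f F_def half_theta_forms_def)
    next
      fix f assume f: "f \<in> half_theta_forms (1 - 8 * int n)"
      obtain a b c where abc: "f = (a, b, c)" by (cases f) auto
      have r: "0 < b" "b < 2 * a" "a < c" "odd (a + c)" "b\<^sup>2 - 4 * a * c = 1 - 8 * int n"
        using f by (auto simp: abc half_theta_forms_def)
      have "odd b" using parity_of_coeffs[OF r(5)] by simp
      \<comment> \<open>Both divisions are exact since \<open>b\<close> and \<open>c - a\<close> are
        odd, and no argument of \<open>nat\<close> is negative.\<close>
      define l m k where "l = nat a" and "m = nat ((b + 1) div 2)" and "k = nat ((c - a - 1) div 2)"
      have "even (b + 1)" "even (c - a - 1)" using r(4) \<open>odd b\<close> by auto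
      then have l: "int l = a" and m: "2 * int m - 1 = b" and k: "int l + 1 + 2 * int k = c"
        using r(1-3) by (simp_all add: l_def m_def k_def del: even_add even_diff) presburger
      have ml: "1 \<le> m" "m \<le> l" using l m r by linarith+
      have "n = (\<Sum>i=m..l. i) + k * l"
        using disc[OF ml, of k] r(5) unfolding k unfolding l m by simp
      then have "(l, m, k) \<in> ?T" using ml by simp
      moreover have "f = F (l, m, k)" using l m k by (simp add: F_def abc)
      ultimately show "f \<in> F ` ?T" by blast
    qed
  qed
  then show ?thesis by (simp add: Q_eq_card_triples bij_betw_same_card)
qed

text \<open>The exceptional forms violate parity: \<open>b\<close> is odd, so it is not 0, and
  \<open>a = b = c\<close> would make both outer coefficients odd.\<close>

lemma class_weight_eq_1:
  assumes "C \<in> form_classes (1 - 8 * n)"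
  shows "class_weight C = 1"
proof -
  have C: "C \<subseteq> pos_def_forms (1 - 8 * n)"
    using assms equiv_bqf_equiv unfolding form_classes_def by (auto dest: in_quotient_imp_subset)
  have disc: "b\<^sup>2 - 4 * a * c = 1 - 8 * n" if "(a, b, c) \<in> C" for a b c
    using that C by (auto simp: pos_def_forms_def)
  have "(t, 0, t) \<notin> C" for t
    using parity_of_coeffs(1)[OF disc] by fastforce
  moreover have "(t, t, t) \<notin> C" for t
    using parity_of_coeffs[OF disc] by blast
  ultimately show ?thesis by (simp add: class_weight_def)
qed

theorem theorem4p2:
  fixes n :: nat
  assumes "n > 0"
  shows "of_nat (Q n) = H (8 * int n - 1)"
proof -
  have "H (8 * int n - 1) = of_nat (card (form_classes (1 - 8 * int n)))"
    by (simp add: H_def class_weight_eq_1)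
  also have "card (form_classes (1 - 8 * int n)) = card (reduced_forms (1 - 8 * int n))"
    using assms by (intro card_form_classes) auto
  also have "\<dots> = Q n"
    using assms by (simp add: card_half_theta_forms Q_eq_card_half_theta_forms)
  finally show ?thesis by simp
qed

end
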